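(* Let $n\ge 2$ and $1\le s\le n$ be integers, let $r_1,\dots,r_s$ be positive integers with $r_1+\dots+r_s=n$, and let $\mathbb E_E=\mathbb E_{n;s;r_1,\dots,r_s}$ be the corresponding generalized tetrablock. If there is $j\in\{1,\dots,s\}$ such that $r_j\ge3$, then $\mathbb E_E$ is neither $\mathbb C$-convex nor starlike about the origin.
   Context: Given integers $n\ge 2$, $1\le s\le n$ and positive integers $r_1,\dots,r_s$ with $\sum_{j=1}^s r_j=n$, let $A(r_1,\dots,r_s)=\{0,\dots,r_1\}\times\dots\times\{0,\dots,r_s\}\setminus\{(0,\dots,0)\}$, totally ordered by: for $\alpha\ne\beta$, $\alpha<\beta$ iff $\alpha_{j_0}<\beta_{j_0}$ where $j_0=\max\{j:\alpha_j\ne\beta_j\}$. Write $A(r_1,\dots,r_s)=\{\alpha^1<\dots<\alpha^N\}$, $N=\prod_{j=1}^s(r_j+1)-1$. For $x\in\mathbb C^N$, $z\in\mathbb C^s$ put $R_x(z)=1+\sum_{j=1}^N(-1)^{|\alpha^j|}x_jz^{\alpha^j}$, where $|\alpha|=\alpha_1+\dots+\alpha_s$ and $z^\alpha=z_1^{\alpha_1}\cdots z_s^{\alpha_s}$. With $\mathbb D$ the open unit disc in $\mathbb C$, the generalized tetrablock is $\mathbb E_E=\mathbb E_{n;s;r_1,\dots,r_s}=\{x\in\mathbb C^N: R_x(z)\neq 0\text{ for all }z\in\overline{\mathbb D}^s\}$ (here $E$ only refers to the space of matrices $\operatorname{diag}[z_1\mathbb I_{r_1},\dots,z_s\mathbb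 I_{r_s}]$). A domain $D\subset\mathbb C^d$ is $\mathbb C$-convex if for any affine complex line $L$ with $L\cap D\neq\varnothing$ the set $L\cap D$ is connected and simply connected. It is starlike about the origin if $tz\in D$ for all $z\in D$, $t\in[0,1]$. *)

theory Defs
  imports "HOL-Analysis.Analysis"
begin

definition multi_indices :: "nat \<Rightarrow> (nat \<Rightarrow> nat) \<Rightarrow> (nat \<Rightarrow> nat) set" where
  "multi_indices s r = (\<Pi>\<^sub>E j\<in>{1..s}. {0..r j}) - {\<lambda>j\<in>{1..s}. 0}"

definition multi_index_less :: "nat \<Rightarrow> (nat \<Rightarrow> nat) \<Rightarrow> (nat \<Rightarrow> nat) \<Rightarrow> bool" where
  "multi_index_less s \<alpha> \<beta> \<longleftrightarrow>
     \<alpha> \<noteq> \<beta> \<and> (let j\<^sub>0 = Max {j\<in>{1..s}. \<alpha> j \<noteq> \<beta> j} in \<alpha> j\<^sub>0 < \<beta> j\<^sub>0)"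

text \<open>The coordinates of \<open>\<complex>\<^sup>N\<close> are indexed by a finite linearly ordered type \<open>'N\<close> with
  \<open>N\<close> elements, which plays the role of \<open>1 < \<dots> < N\<close>.  The enumeration
  \<open>\<alpha>\<^sup>1 < \<dots> < \<alpha>\<^sup>N\<close> is the order isomorphism from \<open>'N\<close> onto the multi-indices; lemma
  \<open>ex1_multi_index_enum\<close> below shows that it is well defined if \<open>'N\<close> has the right cardinality.\<close>

definition is_multi_index_enum ::
    "nat \<Rightarrow> (nat \<Rightarrow> nat) \<Rightarrow> ('N::{finite,linorder} \<Rightarrow> nat \<Rightarrow> nat) \<Rightarrow> bool" where
  "is_multi_index_enum s r a \<longleftrightarrow>
     range a = multi_indices s r \<and> (\<forall>i k. i < k \<longrightarrow> multi_index_less s (a i) (a k))"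

definition multi_index_enum ::
    "nat \<Rightarrow> (nat \<Rightarrow> nat) \<Rightarrow> 'N::{finite,linorder} \<Rightarrow> nat \<Rightarrow> nat" where
  "multi_index_enum s r = (THE a. is_multi_index_enum s r a)"

definition tetrablock_poly ::
    "nat \<Rightarrow> (nat \<Rightarrow> nat) \<Rightarrow> complex ^ 'N::{finite,linorder} \<Rightarrow> (nat \<Rightarrow> complex) \<Rightarrow> complex" where
  "tetrablock_poly s r x z =
     1 + (\<Sum>i\<in>UNIV. let \<alpha> = multi_index_enum s r i in
            (-1) ^ (\<Sum>j=1..s. \<alpha> j) * x $ i * (\<Prod>j=1..s. z j ^ \<alpha> j))"

definition generalized_tetrablock ::
    "nat \<Rightarrow> (nat \<Rightarrow> nat) \<Rightarrow> (complex ^ 'N::{finite,linorder}) set" where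
  "generalized_tetrablock s r =
     {x. \<forall>z \<in> {1..s} \<rightarrow>\<^sub>E cball 0 1. tetrablock_poly s r x z \<noteq> 0}"

definition complex_affine_line :: "(complex ^ 'd) set \<Rightarrow> bool" where
  "complex_affine_line L \<longleftrightarrow> (\<exists>p v. v \<noteq> 0 \<and> L = range (\<lambda>\<zeta>::complex. p + \<zeta> *s v))"

definition C_convex :: "(complex ^ 'd) set \<Rightarrow> bool" where
  "C_convex D \<longleftrightarrow>
     (\<forall>L. complex_affine_line L \<and> L \<inter> D \<noteq> {} \<longrightarrow> connected (L \<inter> D) \<and> simply_connected (L \<inter> D))"

text \<open>The library's \<open>starlike\<close> allows an arbitrary centre.\<close>

definition starlike_about_origin :: "(complex ^ 'd) set \<Rightarrow> bool" where
  "starlike_about_origin D \<longleftrightarrow> (\<forall>z\<in>D. \<forall>t\<in>{0..1::real}. t *\<^sub>R z \<in> D)"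

lemma finite_multi_indices: "finite (multi_indices s r)"
  unfolding multi_indices_def by (intro finite_Diff finite_PiE) auto

lemma card_multi_indices: "card (multi_indices s r) = (\<Prod>j=1..s. r j + 1) - 1"
proof -
  have "(\<lambda>j\<in>{1..s}. 0) \<in> (\<Pi>\<^sub>E j\<in>{1..s}. {0..r j})" by auto
  then show ?thesis
    unfolding multi_indices_def by (simp add: card_Diff_singleton card_PiE)
qed

lemma multi_index_diff:
  assumes "\<alpha> \<in> multi_indices s r" "\<beta> \<in> multi_indices s r" "\<alpha> \<noteq> \<beta>"
  shows "Max {j\<in>{1..s}. \<alpha> j \<noteq> \<beta> j} \<in> {j\<in>{1..s}. \<alpha> j \<noteq> \<beta> j}"
proof -
  have "\<exists>j\<in>{1..s}. \<alpha> j \<noteq> \<beta> j"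
    using assms PiE_ext[of \<alpha> "{1..s}" _ \<beta>] unfolding multi_indices_def by blast
  then have "{j\<in>{1..s}. \<alpha> j \<noteq> \<beta> j} \<noteq> {}" by blast
  then show ?thesis by (intro Max_in) auto
qed

lemma multi_index_less_iff:
  assumes "\<alpha> \<in> multi_indices s r" "\<beta> \<in> multi_indices s r"
  shows "multi_index_less s \<alpha> \<beta> \<longleftrightarrow>
    (\<exists>m\<in>{1..s}. \<alpha> m < \<beta> m \<and> (\<forall>j\<in>{1..s}. m < j \<longrightarrow> \<alpha> j = \<beta> j))"  (is "?l \<longleftrightarrow> ?r")
proof
  assume ?l
  define m where "m = Max {j\<in>{1..s}. \<alpha> j \<noteq> \<beta> j}"
  have "\<alpha> \<noteq> \<beta>" and less: "\<alpha> m < \<beta> m"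
    using \<open>?l\<close> unfolding multi_index_less_def Let_def m_def by blast+
  have "m \<in> {1..s}"
    using multi_index_diff[OF assms \<open>\<alpha> \<noteq> \<beta>\<close>] unfolding m_def by blast
  moreover note less
  moreover have "\<alpha> j = \<beta> j" if "j \<in> {1..s}" "m < j" for j
  proof (rule ccontr)
    assume "\<alpha> j \<noteq> \<beta> j"
    then have "j \<le> m" unfolding m_def using that by (intro Max_ge) auto
    with that show False by simp
  qed
  ultimately show ?r by blast
next
  assume ?r
  then obtain m where m: "m \<in> {1..s}" "\<alpha> m < \<beta> m" "\<And>j. j \<in> {1..s} \<Longrightarrow> m < j \<Longrightarrow> \<alpha> j = \<beta> j"
    by blast
  have Max_eq: "Max {j\<in>{1..s}. \<alpha> j \<noteq> \<beta> j} = m"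
  proof (rule Max_eqI)
    show "finite {j\<in>{1..s}. \<alpha> j \<noteq> \<beta> j}" by simp
    show "y \<le> m" if "y \<in> {j\<in>{1..s}. \<alpha> j \<noteq> \<beta> j}" for y
    proof (rule ccontr)
      assume "\<not> y \<le> m"
      then show False using m(3)[of y] that by simp
    qed
    show "m \<in> {j\<in>{1..s}. \<alpha> j \<noteq> \<beta> j}" using m(1,2) by simp
  qed
  have "\<alpha> \<noteq> \<beta>" using m(2) by blast
  with m(2) show ?l unfolding multi_index_less_def Let_def Max_eq by blast
qed

lemma multi_index_less_irrefl: "\<not> multi_index_less s \<alpha> \<alpha>"
  by (simp add: multi_index_less_def)

lemma multi_index_less_total:
  assumes "\<alpha> \<in> multi_indices s r" "\<beta> \<in> multi_indices s r" "\<alpha> \<noteq> \<beta>"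
  shows "multi_index_less s \<alpha> \<beta> \<or> multi_index_less s \<beta> \<alpha>"
proof -
  define m where "m = Max {j\<in>{1..s}. \<alpha> j \<noteq> \<beta> j}"
  have "\<alpha> m \<noteq> \<beta> m"
    using multi_index_diff[OF assms] unfolding m_def by blast
  moreover have "(\<lambda>j. j \<in> {1..s} \<and> \<beta> j \<noteq> \<alpha> j) = (\<lambda>j. j \<in> {1..s} \<and> \<alpha> j \<noteq> \<beta> j)"
    by (rule ext) (rule conj_cong[OF refl], rule neq_commute)
  then have "m = Max {j\<in>{1..s}. \<beta> j \<noteq> \<alpha> j}"
    unfolding m_def by (rule arg_cong[where f = "\<lambda>P. Max (Collect P)", OF sym])
  ultimately show ?thesis
    using assms(3) unfolding multi_index_less_def Let_def m_def[symmetric]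
    by (metis linorder_neqE_nat)
qed

lemma multi_index_less_trans:
  assumes "\<alpha> \<in> multi_indices s r" "\<beta> \<in> multi_indices s r" "\<gamma> \<in> multi_indices s r"
    and "multi_index_less s \<alpha> \<beta>" "multi_index_less s \<beta> \<gamma>"
  shows "multi_index_less s \<alpha> \<gamma>"
proof -
  obtain m where m: "m\<in>{1..s}" "\<alpha> m < \<beta> m" "\<And>j. j \<in> {1..s} \<Longrightarrow> m < j \<Longrightarrow> \<alpha> j = \<beta> j"
    using assms(4) unfolding multi_index_less_iff[OF assms(1,2)] by blast
  obtain k where k: "k\<in>{1..s}" "\<beta> k < \<gamma> k" "\<And>j. j \<in> {1..s} \<Longrightarrow> k < j \<Longrightarrow> \<beta> j = \<gamma> j"
    using assms(5) unfolding multi_index_less_iff[OF assms(2,3)] by blast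
  have "\<alpha> (max m k) < \<gamma> (max m k)"
    using m(2) m(3)[of k] k(2) k(3)[of m] m(1) k(1) by (cases m k rule: linorder_cases) auto
  moreover have "max m k \<in> {1..s}" using m(1) k(1) by (auto simp: max_def)
  moreover have "\<forall>j\<in>{1..s}. max m k < j \<longrightarrow> \<alpha> j = \<gamma> j" using m(3) k(3) by auto
  ultimately show ?thesis using multi_index_less_iff[OF assms(1,3)] by blast
qed

lemma multi_index_rank_strict_mono:
  assumes "\<alpha> \<in> multi_indices s r" "\<beta> \<in> multi_indices s r" "multi_index_less s \<alpha> \<beta>"
  shows "card {\<gamma>\<in>multi_indices s r. multi_index_less s \<gamma> \<alpha>}
       < card {\<gamma>\<in>multi_indices s r. multi_index_less s \<gamma> \<beta>}"
proof (rule psubset_card_mono)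
  show "finite {\<gamma>\<in>multi_indices s r. multi_index_less s \<gamma> \<beta>}"
    by (simp add: finite_multi_indices)
  show "{\<gamma>\<in>multi_indices s r. multi_index_less s \<gamma> \<alpha>} \<subset>
        {\<gamma>\<in>multi_indices s r. multi_index_less s \<gamma> \<beta>}"
    using assms multi_index_less_trans[OF _ assms(1,2) _ assms(3)] multi_index_less_irrefl[of s \<alpha>]
    by auto
qed

lemma ex1_multi_index_enum:
  assumes "CARD('N::{finite,linorder}) = (\<Prod>j=1..s. r j + 1) - 1"
  shows "\<exists>!a :: 'N \<Rightarrow> nat \<Rightarrow> nat. is_multi_index_enum s r a"
proof -
  let ?A = "multi_indices s r"
  define \<rho> where "\<rho> \<alpha> = card {\<gamma>\<in>?A. multi_index_less s \<gamma> \<alpha>}" for \<alpha>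
  define \<sigma> where "\<sigma> i = card {k. k < i}" for i :: 'N
  have \<rho>_mono: "\<rho> \<alpha> < \<rho> \<beta>" if "\<alpha> \<in> ?A" "\<beta> \<in> ?A" "multi_index_less s \<alpha> \<beta>" for \<alpha> \<beta>
    using multi_index_rank_strict_mono that unfolding \<rho>_def by blast
  have \<sigma>_mono: "\<sigma> i < \<sigma> k" if "i < k" for i k
    unfolding \<sigma>_def using that by (intro psubset_card_mono) auto
  have \<rho>_inj: "inj_on \<rho> ?A"
    by (rule inj_onI) (metis \<rho>_mono multi_index_less_total nat_neq_iff)
  have \<sigma>_inj: "inj \<sigma>"
    by (rule injI) (metis \<sigma>_mono less_irrefl linorder_less_linear)
  have card_eq: "card ?A = CARD('N)" using assms card_multi_indices by simp
  have "\<rho> \<alpha> < card ?A" if "\<alpha> \<in> ?A" for \<alpha>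
    unfolding \<rho>_def
  proof (rule psubset_card_mono[OF finite_multi_indices])
    have "\<alpha> \<notin> {\<gamma>\<in>?A. multi_index_less s \<gamma> \<alpha>}" by (simp add: multi_index_less_irrefl)
    with that show "{\<gamma>\<in>?A. multi_index_less s \<gamma> \<alpha>} \<subset> ?A" by blast
  qed
  then have "\<rho> ` ?A \<subseteq> {..<card ?A}" by auto
  then have \<rho>_img: "\<rho> ` ?A = {..<card ?A}"
    by (intro card_subset_eq) (auto simp: card_image[OF \<rho>_inj])
  have "\<sigma> i < CARD('N)" for i
    unfolding \<sigma>_def by (intro psubset_card_mono) auto
  then have "range \<sigma> \<subseteq> {..<card ?A}" by (auto simp: card_eq)
  then have \<sigma>_img: "range \<sigma> = {..<card ?A}"
    by (intro card_subset_eq) (auto simp: card_image[OF \<sigma>_inj] card_eq)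
  define a where "a i = inv_into ?A \<rho> (\<sigma> i)" for i
  have "\<sigma> i \<in> \<rho> ` ?A" for i using \<rho>_img \<sigma>_img by blast
  then have a_in: "a i \<in> ?A" and \<rho>_a: "\<rho> (a i) = \<sigma> i" for i
    unfolding a_def by (rule inv_into_into, rule f_inv_into_f)
  have enum_a: "is_multi_index_enum s r a"
    unfolding is_multi_index_enum_def
  proof (intro conjI allI impI)
    show "range a = ?A"
    proof
      show "?A \<subseteq> range a"
      proof
        fix \<alpha> assume \<alpha>: "\<alpha> \<in> ?A"
        then obtain i where "\<sigma> i = \<rho> \<alpha>" using \<rho>_img \<sigma>_img by (metis imageE imageI)
        then have "a i = \<alpha>" using \<rho>_inj \<alpha> by (simp add: a_def)
        then show "\<alpha> \<in> range a" by blast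
      qed
    qed (use a_in in auto)
    fix i k :: 'N assume ik: "i < k"
    then have "\<rho> (a i) < \<rho> (a k)" using \<sigma>_mono \<rho>_a by simp
    then show "multi_index_less s (a i) (a k)"
      using \<rho>_mono a_in multi_index_less_total by (metis less_asym less_irrefl)
  qed
  have "b = a" if b: "is_multi_index_enum s r b" for b
  proof
    fix i
    have ran: "range b = ?A" and mono: "\<And>i k. i < k \<Longrightarrow> multi_index_less s (b i) (b k)"
      using b by (auto simp: is_multi_index_enum_def)
    have b_in: "b k \<in> ?A" for k using ran by auto
    have b_inj: "inj b"
      by (rule injI) (metis mono multi_index_less_irrefl linorder_less_linear)
    have iff: "multi_index_less s (b k) (b i) \<longleftrightarrow> k < i" for k
      using mono multi_index_less_trans[OF b_in b_in b_in] multi_index_less_irrefl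
      by (metis linorder_less_linear)
    have "{\<gamma>\<in>?A. multi_index_less s \<gamma> (b i)} = b ` {k. k < i}"
      using iff by (auto simp flip: ran)
    then have "\<rho> (b i) = \<sigma> i"
      unfolding \<rho>_def \<sigma>_def using b_inj by (simp add: card_image inj_on_subset)
    then show "b i = a i" using \<rho>_a[of i] \<rho>_inj b_in a_in by (metis inj_onD)
  qed
  with enum_a show ?thesis by blast
qed

end

theory Submission
  imports Defs
begin

text \<open>
  Fix \<open>j\<close> with \<open>r\<^sub>j \<ge> 3\<close>.  The coordinates belonging to multi-indices supported at \<open>j\<close> suffice to
  realise every polynomial in \<open>z\<^sub>j\<close> of degree at most \<open>r\<^sub>j\<close> with constant term \<open>1\<close> as some \<open>R\<^sub>x\<close>.
  In particular there is a vector \<open>v\<close> with \<open>R\<^sub>v(z) = (1 - \<rho> z\<^sub>j)\<^sup>3\<close>, and on the complex line through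
  \<open>0\<close> and \<open>v\<close> one gets \<open>R\<^bsub>\<zeta>v\<^esub>(z) = 1 + \<zeta> ((1 - \<rho> z\<^sub>j)\<^sup>3 - 1)\<close>, see \<open>tetrablock_poly_axis_power\<close>.
  For \<open>0 \<le> \<rho> < 1\<close> both \<open>0\<close> and \<open>v\<close> lie in the tetrablock.

  A parameter \<open>\<zeta> \<noteq> 0\<close> is excluded exactly if \<open>1 - 1/\<zeta>\<close> is a value of \<open>(1 - \<rho> z)\<^sup>3\<close> on the closed
  disc.  The disc of centre \<open>1\<close> and radius \<open>\<rho>\<close>, for \<open>\<rho>\<close> close to \<open>1\<close>, is seen from the origin under
  an angle close to \<open>\<pi>\<close>.  Cubing triples this angle to something larger than \<open>2\<pi>\<close>, so the image of
  the disc wraps around the origin without covering it.  It contains a whole circle about the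
  origin; pulled back to \<open>\<zeta>\<close> this is the Apollonius circle \<open>\<bar>\<zeta> - 1\<bar> = \<bar>\<zeta>\<bar> / 8\<close>, on which no point
  \<open>\<zeta>v\<close> is in the tetrablock (\<open>zero_on_apollonius_circle\<close>).  The circle separates \<open>\<zeta> = 1\<close> from
  \<open>\<zeta> = 0\<close>, so the slice by this line is disconnected, and it meets the segment from \<open>0\<close> to \<open>1\<close> (at
  \<open>\<zeta> = 8/9\<close>), so the tetrablock is not starlike about the origin.  Squaring instead of cubing would
  only double the angle and leave a gap, which is where degree three enters.
\<close>

section \<open>The enumeration of multi-indices\<close>

lemma bij_betw_multi_index_enum:
  assumes "CARD('N::{finite,linorder}) = (\<Prod>j=1..s. r j + 1) - 1"
  shows "bij_betw (multi_index_enum s r :: 'N::{finite,linorder} \<Rightarrow> nat \<Rightarrow> nat) UNIV (multi_indices s r)"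
proof -
  have enum: "is_multi_index_enum s r (multi_index_enum s r :: 'N \<Rightarrow> nat \<Rightarrow> nat)"
    unfolding multi_index_enum_def by (rule theI'[OF ex1_multi_index_enum[OF assms]])
  then have "inj (multi_index_enum s r :: 'N \<Rightarrow> nat \<Rightarrow> nat)"
    unfolding is_multi_index_enum_def
    by (intro injI) (metis multi_index_less_irrefl linorder_less_linear)
  with enum show ?thesis
    by (simp add: is_multi_index_enum_def bij_betw_def)
qed

definition axis_index :: "nat \<Rightarrow> nat \<Rightarrow> nat \<Rightarrow> nat \<Rightarrow> nat" where
  "axis_index s j k = (\<lambda>l\<in>{1..s}. if l = j then k else 0)"

lemma axis_index_same [simp]: "j \<in> {1..s} \<Longrightarrow> axis_index s j k j = k"
  by (simp add: axis_index_def)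

lemma axis_index_in_multi_indices:
  assumes "j \<in> {1..s}"
  shows "axis_index s j k \<in> multi_indices s r \<longleftrightarrow> 1 \<le> k \<and> k \<le> r j"
proof -
  have "axis_index s j k = (\<lambda>l\<in>{1..s}. 0) \<longleftrightarrow> k = 0"
  proof
    assume "axis_index s j k = (\<lambda>l\<in>{1..s}. 0)"
    then have "axis_index s j k j = (\<lambda>l\<in>{1..s}. 0) j" by simp
    with assms show "k = 0" by simp
  qed (auto simp: axis_index_def fun_eq_iff)
  moreover have "axis_index s j k \<in> (\<Pi>\<^sub>E l\<in>{1..s}. {0..r l}) \<longleftrightarrow> k \<le> r j"
    using assms by (auto simp: axis_index_def PiE_iff)
  ultimately show ?thesis by (auto simp: multi_indices_def)
qed

lemma sum_axis_index:
  assumes "j \<in> {1..s}"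
  shows "(\<Sum>l=1..s. axis_index s j k l) = k"
  using assms by (simp add: axis_index_def)

lemma prod_axis_index:
  fixes z :: "nat \<Rightarrow> 'a::comm_semiring_1"
  assumes "j \<in> {1..s}"
  shows "(\<Prod>l=1..s. z l ^ axis_index s j k l) = z j ^ k"
proof -
  have "(\<Prod>l=1..s. z l ^ axis_index s j k l) = (\<Prod>l=1..s. if l = j then z l ^ k else 1)"
    by (rule prod.cong) (auto simp: axis_index_def)
  with assms show ?thesis by simp
qed

section \<open>A line of one-variable polynomials\<close>

text \<open>The point \<open>x\<close> with \<open>R\<^sub>x(z) = (1 - \<rho> z\<^sub>j)\<^sup>m\<close>.  The signs of the binomial expansion are those
  built into \<open>R\<^sub>x\<close>, so they do not occur here.\<close>

definition axis_power :: "nat \<Rightarrow> (nat \<Rightarrow> nat) \<Rightarrow> nat \<Rightarrow> nat \<Rightarrow> complex \<Rightarrow> complex ^ 'N::{finite,linorder}"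
  where "axis_power s r j m \<rho> = (\<chi> i. let \<alpha> = multi_index_enum s r i in
    if \<alpha> = axis_index s j (\<alpha> j) then of_nat (m choose \<alpha> j) * \<rho> ^ \<alpha> j else 0)"

text \<open>The binomial theorem for \<open>(1 - \<rho> z\<^sub>j)\<^sup>m\<close> without its constant term.  The bound \<open>m \<le> r\<^sub>j\<close>
  guarantees that none of its monomials is missing from the index set.\<close>

lemma tetrablock_poly_axis_power:
  assumes card: "CARD('N::{finite,linorder}) = (\<Prod>j=1..s. r j + 1) - 1"
    and j: "j \<in> {1..s}" and m: "m \<le> r j"
  shows "tetrablock_poly s r (\<zeta> *s (axis_power s r j m \<rho> :: complex ^ 'N::{finite,linorder})) z
    = 1 + \<zeta> * ((1 - \<rho> * z j) ^ m - 1)"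
proof -
  define F where "F \<alpha> = (-1) ^ (\<Sum>l=1..s. \<alpha> l) *
    (\<zeta> * (if \<alpha> = axis_index s j (\<alpha> j) then of_nat (m choose \<alpha> j) * \<rho> ^ \<alpha> j else 0)) *
    (\<Prod>l=1..s. z l ^ \<alpha> l)" for \<alpha>
  have term_axis: "F (axis_index s j k) = \<zeta> * (of_nat (m choose k) * (- \<rho> * z j) ^ k)" for k
    unfolding F_def sum_axis_index[OF j] prod_axis_index[OF j] axis_index_same[OF j]
    by (simp add: power_mult_distrib power_minus[of "\<rho> * z j"] mult_ac)
  have inj: "inj_on (axis_index s j) {1..r j}"
    by (rule inj_onI) (metis axis_index_same j)
  have "tetrablock_poly s r (\<zeta> *s (axis_power s r j m \<rho> :: complex ^ 'N::{finite,linorder})) z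
      = 1 + (\<Sum>i\<in>(UNIV :: 'N::{finite,linorder} set). F (multi_index_enum s r i))"
    by (simp add: tetrablock_poly_def axis_power_def F_def Let_def)
  also have "\<dots> = 1 + sum F (multi_indices s r)"
    by (simp add: sum.reindex_bij_betw[OF bij_betw_multi_index_enum[OF card]])
  also have "sum F (multi_indices s r) = sum F (axis_index s j ` {1..r j})"
  proof (rule sum.mono_neutral_right[OF finite_multi_indices])
    show "axis_index s j ` {1..r j} \<subseteq> multi_indices s r"
      using axis_index_in_multi_indices[OF j] by auto
    show "\<forall>\<alpha>\<in>multi_indices s r - axis_index s j ` {1..r j}. F \<alpha> = 0"
    proof
      fix \<alpha> assume \<alpha>: "\<alpha> \<in> multi_indices s r - axis_index s j ` {1..r j}"
      then have "\<alpha> \<noteq> axis_index s j (\<alpha> j)"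
        using axis_index_in_multi_indices[OF j, of "\<alpha> j" r] by force
      then show "F \<alpha> = 0" by (simp add: F_def)
    qed
  qed
  also have "\<dots> = (\<Sum>k=1..r j. \<zeta> * (of_nat (m choose k) * (- \<rho> * z j) ^ k))"
    unfolding sum.reindex[OF inj] o_def term_axis ..
  also have "\<dots> = (\<Sum>k=1..m. \<zeta> * (of_nat (m choose k) * (- \<rho> * z j) ^ k))"
    using m by (intro sum.mono_neutral_right) auto
  also have "\<dots> = \<zeta> * ((\<Sum>k\<le>m. of_nat (m choose k) * (- \<rho> * z j) ^ k) - 1)"
    by (simp add: sum_distrib_left[symmetric] atMost_atLeast0 sum.atLeast_Suc_atMost)
  also have "(\<Sum>k\<le>m. of_nat (m choose k) * (- \<rho> * z j) ^ k) = (1 - \<rho> * z j) ^ m"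
    using binomial_ring[of "- \<rho> * z j" 1 m] by simp
  finally show ?thesis .
qed

lemma axis_power_in_generalized_tetrablock:
  assumes card: "CARD('N::{finite,linorder}) = (\<Prod>j=1..s. r j + 1) - 1"
    and j: "j \<in> {1..s}" and m: "m \<le> r j" and \<rho>: "norm \<rho> < 1"
  shows "(axis_power s r j m \<rho> :: complex ^ 'N::{finite,linorder}) \<in> generalized_tetrablock s r"
proof -
  have "(1 - \<rho> * z j) ^ m \<noteq> 0" if "z \<in> {1..s} \<rightarrow>\<^sub>E cball 0 1" for z
  proof -
    have "norm (z j) \<le> 1" using that j by (auto simp: PiE_iff)
    then have "norm (\<rho> * z j) < 1"
      using \<rho> by (simp add: norm_mult) (metis mult_left_le norm_ge_zero order_le_less_trans)
    then have "\<rho> * z j \<noteq> 1" by auto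
    then show ?thesis by simp
  qed
  then show ?thesis
    using tetrablock_poly_axis_power[OF card j m, of 1 \<rho>]
    by (simp add: generalized_tetrablock_def)
qed

lemma zero_in_generalized_tetrablock: "0 \<in> generalized_tetrablock s r"
  by (simp add: generalized_tetrablock_def tetrablock_poly_def)

section \<open>The excluded circle\<close>

text \<open>Cube roots may be chosen in the sector of opening angle \<open>2\<pi>/3\<close> around the positive axis: divide
  the principal argument by three.\<close>

lemma cube_root_in_sector:
  obtains u :: complex where "u ^ 3 = w" "norm u = root 3 (norm w)" "norm u / 2 \<le> Re u"
proof
  define u where "u = rcis (root 3 (norm w)) (Arg w / 3)"
  show "u ^ 3 = w"
    by (simp add: u_def DeMoivre2 rcis_cmod_Arg)
  show norm_u: "norm u = root 3 (norm w)"
    by (simp add: u_def)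
  have "cos (pi / 3) \<le> cos \<bar>Arg w / 3\<bar>"
    using Arg_bounded[of w] by (intro cos_monotone_0_pi_le) auto
  then have "1 / 2 \<le> cos (Arg w / 3)" by (simp only: cos_60 cos_abs_real)
  then have "root 3 (norm w) * (1 / 2) \<le> root 3 (norm w) * cos (Arg w / 3)"
    by (intro mult_left_mono) auto
  then show "norm u / 2 \<le> Re u"
    by (simp add: norm_u) (simp add: u_def)
qed

text \<open>The value \<open>1/8\<close> makes the cube root \<open>u\<close> of \<open>1 - 1/\<zeta>\<close> have modulus \<open>1/2\<close>, which minimises the
  bound \<open>\<bar>1 - u\<bar>\<^sup>2 \<le> 1 - \<bar>u\<bar> + \<bar>u\<bar>\<^sup>2\<close> valid in the sector; its minimum is \<open>3/4\<close>, and
  \<open>(1 - u) / \<rho>\<close> is the zero.\<close>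

lemma zero_on_apollonius_circle:
  fixes \<zeta> \<rho> :: complex
  assumes \<rho>: "3 / 4 \<le> (norm \<rho>)\<^sup>2" and \<zeta>: "norm (\<zeta> - 1) = norm \<zeta> / 8"
  obtains w where "norm w \<le> 1" "1 + \<zeta> * ((1 - \<rho> * w) ^ 3 - 1) = 0"
proof -
  have nz: "\<zeta> \<noteq> 0" "\<rho> \<noteq> 0" using assms by auto
  have "norm (1 - 1 / \<zeta>) = norm ((\<zeta> - 1) / \<zeta>)"
    using nz by (simp add: field_simps)
  also have "\<dots> = 1 / 8" using \<zeta> nz by (simp add: norm_divide)
  finally have norm: "norm (1 - 1 / \<zeta>) = 1 / 8" .
  obtain u where u: "u ^ 3 = 1 - 1 / \<zeta>" "norm u = root 3 (1 / 8)" "norm u / 2 \<le> Re u"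
    using cube_root_in_sector norm by metis
  have "root 3 (1 / 8) = 1 / 2"
    by (rule real_root_pos_unique) (simp_all add: power3_eq_cube)
  with u(2) have norm_u: "norm u = 1 / 2" by simp
  have "(norm (1 - u))\<^sup>2 = 1 + (norm u)\<^sup>2 - 2 * Re u"
    unfolding cmod_power2 by (simp add: power2_eq_square algebra_simps)
  also have "\<dots> \<le> (norm \<rho>)\<^sup>2" using \<rho> u(3) by (simp add: norm_u power2_eq_square)
  finally have "norm (1 - u) \<le> norm \<rho>" by (rule power2_le_imp_le) simp
  then have "norm ((1 - u) / \<rho>) \<le> 1" using nz by (simp add: norm_divide)
  moreover have "1 + \<zeta> * ((1 - \<rho> * ((1 - u) / \<rho>)) ^ 3 - 1) = 0"
    using nz u(1) by (simp add: field_simps)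
  ultimately show thesis by (rule that)
qed

lemma axis_power_cube_excluded:
  assumes card: "CARD('N::{finite,linorder}) = (\<Prod>j=1..s. r j + 1) - 1"
    and j: "j \<in> {1..s}" and m: "3 \<le> r j"
    and "3 / 4 \<le> (norm \<rho>)\<^sup>2" and "norm (\<zeta> - 1) = norm \<zeta> / 8"
  shows "\<zeta> *s (axis_power s r j 3 \<rho> :: complex ^ 'N::{finite,linorder}) \<notin> generalized_tetrablock s r"
proof -
  obtain w where w: "norm w \<le> 1" "1 + \<zeta> * ((1 - \<rho> * w) ^ 3 - 1) = 0"
    using zero_on_apollonius_circle assms(4,5) by blast
  define z where "z = (\<lambda>l\<in>{1..s}. w)"
  have "z \<in> {1..s} \<rightarrow>\<^sub>E cball 0 1" using w(1) by (auto simp: z_def)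
  moreover have "tetrablock_poly s r
      (\<zeta> *s (axis_power s r j 3 \<rho> :: complex ^ 'N::{finite,linorder})) z = 0"
    using tetrablock_poly_axis_power[OF card j m, of \<zeta> \<rho> z] w(2) j by (simp add: z_def)
  ultimately show ?thesis by (auto simp: generalized_tetrablock_def)
qed

section \<open>Failure of both convexity properties\<close>

theorem proposition3p14:
  fixes n s :: nat and r :: "nat \<Rightarrow> nat"
  assumes "n \<ge> 2"
    and "1 \<le> s" and "s \<le> n"
    and "\<forall>j\<in>{1..s}. r j > 0"
    and "(\<Sum>j=1..s. r j) = n"
    and "CARD('N::{finite,linorder}) = (\<Prod>j=1..s. r j + 1) - 1"
    and "\<exists>j\<in>{1..s}. r j \<ge> 3"
  shows "\<not> C_convex (generalized_tetrablock s r :: (complex ^ 'N::{finite,linorder}) set) \<and>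
         \<not> starlike_about_origin (generalized_tetrablock s r :: (complex ^ 'N::{finite,linorder}) set)"
proof -
  let ?D = "generalized_tetrablock s r :: (complex ^ 'N::{finite,linorder}) set"
  obtain j where j: "j \<in> {1..s}" "3 \<le> r j" using assms(7) by blast
  \<comment> \<open>\<open>9/10\<close> lies between \<open>\<surd>3 / 2\<close>, where the excluded circle appears, and \<open>1\<close>, where \<open>v\<close> would
    leave the tetrablock.\<close>
  define v :: "complex ^ 'N::{finite,linorder}" where "v = axis_power s r j 3 (9 / 10)"
  have v_in: "v \<in> ?D"
    unfolding v_def by (rule axis_power_in_generalized_tetrablock[OF assms(6) j]) simp
  have excluded: "\<zeta> *s v \<notin> ?D" if "norm (\<zeta> - 1) = norm \<zeta> / 8" for \<zeta>
    unfolding v_def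
    by (rule axis_power_cube_excluded[OF assms(6) j _ that]) (simp add: power2_eq_square)
  have "axis_index s j 1 \<in> multi_indices s r"
    using axis_index_in_multi_indices[OF j(1), of 1 r] j(2) by simp
  then obtain i :: 'N where i: "multi_index_enum s r i = axis_index s j 1"
    using bij_betw_multi_index_enum[OF assms(6)] by (metis bij_betw_imp_surj_on imageE)
  have v_i: "v $ i = 27 / 10"
    using j(1) by (simp add: v_def axis_power_def i)

  have "\<not> C_convex ?D"
  proof
    assume "C_convex ?D"
    define L where "L = range (\<lambda>\<zeta>::complex. 0 + \<zeta> *s v)"
    have "v \<noteq> 0" using v_i by auto
    then have line: "complex_affine_line L"
      unfolding complex_affine_line_def L_def by blast
    have zero: "0 \<in> L \<inter> ?D"
      using zero_in_generalized_tetrablock by (auto simp: L_def intro: range_eqI[of _ _ 0])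
    have one: "v \<in> L \<inter> ?D"
      using v_in by (auto simp: L_def intro: range_eqI[of _ _ 1])
    have conn: "connected (L \<inter> ?D)"
      using \<open>C_convex ?D\<close> line zero unfolding C_convex_def by blast
    \<comment> \<open>The \<open>i\<close>-th coordinate recovers the parameter \<open>\<zeta>\<close> of a point of the line, so \<open>h\<close> is the
        defining function of the excluded circle.\<close>
    define h where "h x = norm (x $ i / (27 / 10) - 1) - norm (x $ i / (27 / 10)) / 8"
      for x :: "complex ^ 'N::{finite,linorder}"
    have "connected (h ` (L \<inter> ?D))"
      unfolding h_def by (intro connected_continuous_image[OF _ conn] continuous_intros) auto
    moreover have "h v < 0" "0 < h 0" by (simp_all add: h_def v_i)
    ultimately have "0 \<in> h ` (L \<inter> ?D)"
      using one zero connectedD_interval[of "h ` (L \<inter> ?D)" "h v" "h 0" 0] by auto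
    then obtain \<zeta> where "\<zeta> *s v \<in> ?D" "h (\<zeta> *s v) = 0"
      by (auto simp: L_def)
    then show False using excluded[of \<zeta>] by (simp add: h_def v_i)
  qed
  moreover have "\<not> starlike_about_origin ?D"
  proof
    assume "starlike_about_origin ?D"
    then have "(8 / 9 :: real) *\<^sub>R v \<in> ?D"
      using v_in unfolding starlike_about_origin_def by auto
    moreover have "(8 / 9 :: real) *\<^sub>R v = (8 / 9 :: complex) *s v"
      unfolding vec_eq_iff vector_scaleR_component by (simp add: scaleR_conv_of_real)
    ultimately show False using excluded[of "8 / 9"] by simp
  qed
  ultimately show ?thesis by blast
qed

end
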